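(* Let $n\ge 1$ and $d\ge 2$ be integers, let $A_1,\dots,A_n$ be $n$ qudit systems, each with Hilbert space $\mathbb{C}^d$ and orthonormal basis $|0\rangle,\dots,|d-1\rangle$, and let $$|W_n^d\rangle_{A_1\cdots A_n}=\sum_{i=1}^{d-1}\bigl(a_{1i}|i0\cdots 0\rangle+a_{2i}|0i\cdots 0\rangle+\cdots+a_{ni}|0\cdots 0i\rangle\bigr)_{A_1\cdots A_n},\qquad a_{si}\in\mathbb{C},\quad \sum_{s=1}^n\sum_{i=1}^{d-1}|a_{si}|^2=1,$$ be an $n$-qudit generalized W-class state. Then for any partition $P=\{P_1,\dots,P_m\}$ of the set of subsystems $S=\{A_1,\dots,A_n\}$ and every $s\in\{1,\dots,m\}$, with all concurrences and concurrences of assistance taken with respect to $|W_n^d\rangle$ and its reduced states, $$\mathcal{C}_{P_s(P_1\cdots\widehat{P}_s\cdots P_m)}^2=\sum_{k\ne s}\mathcal{C}_{P_sP_k}^2=\sum_{k\ne s}(\mathcal{C}_{P_sP_k}^a)^2,$$ and $\mathcal{C}_{P_sP_k}=\mathcal{C}^a_{P_sP_k}$ for all $k\ne s$.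
   Context: Concurrence. For a normalized pure state $|\phi\rangle_{AB}$ of a bipartite finite-dimensional system $\mathcal{H}_A\otimes\mathcal{H}_B$, $\mathcal{C}(|\phi\rangle_{AB})=\sqrt{2(1-\mathrm{tr}\,\rho_A^2)}$, where $\rho_A=\mathrm{tr}_B|\phi\rangle\langle\phi|$. For a mixed state (density operator) $\rho_{AB}$, the concurrence is $\mathcal{C}(\rho_{AB})=\min\sum_k p_k\,\mathcal{C}(|\phi_k\rangle_{AB})$ and the concurrence of assistance is $\mathcal{C}^a(\rho_{AB})=\max\sum_k p_k\,\mathcal{C}(|\phi_k\rangle_{AB})$, where the minimum and the maximum are over all (finite) pure state decompositions $\rho_{AB}=\sum_k p_k|\phi_k\rangle\langle\phi_k|$ with $p_k\geq 0$, $\sum_k p_k=1$, and the $|\phi_k\rangle$ normalized. Notation. Given a state of $A_1\otimes\cdots\otimes A_n$ and disjoint sets $X,Y$ of subsystems, $\mathcal{C}_{XY}$ (also written $\mathcal{C}_{X(Y)}$) and $\mathcal{C}^a_{XY}$ denote the concurrence and concurrence of assistance of the reduced state $\rho_{XY}$ on $X\cup Y$ (obtained by the partial trace over all other subsystems), viewed as a bipartite state with respect to the cut between $X$ and $Y$. If $X\cup Y$ is the whole set of subsystems, $\rho_{XY}$ is the given state itself. A partition $P=\{P_1,\dots,P_m\}$ of $S$ consists of nonempty pairwise disjoint sets with union $S$; each $P_s$ is regarded as one party, whose Hilbert space is the tensor product of the spaces of the qudits in it. A hat denotes omission, so $P_1\cdots\widehat{P}_s\cdots P_m$ is the joint system of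 all parties other than $P_s$. An empty tensor product is $\mathbb{C}$. *)

theory Defs
  imports "HOL-Analysis.Analysis"
begin

text \<open>
  Subsystems are labelled by natural numbers, each with Hilbert space $\mathbb{C}^d$. The space of
  a finite set \<open>X\<close> of subsystems, $(\mathbb{C}^d)^{\otimes X}$, has the orthonormal product basis
  \<open>|x\<rangle>\<close>, where \<open>x\<close> ranges over the functions from \<open>X\<close> to \<open>{0, ..., d - 1}\<close>. Vectors and
  operators on \<open>X\<close> are given by their coordinates in this basis; values at arguments outside
  \<open>basis d X\<close> play no role. The basis of the empty system has exactly one element.
  For disjoint \<open>X\<close> and \<open>Y\<close>, the basis vector \<open>|x\<rangle> \<otimes> |y\<rangle>\<close> of \<open>X \<union> Y\<close> is
  \<open>|merge X Y (x, y)\<rangle>\<close>.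
\<close>

type_synonym config = "nat \<Rightarrow> nat"
type_synonym state_vec = "config \<Rightarrow> complex"
type_synonym operator = "config \<Rightarrow> config \<Rightarrow> complex"

definition basis :: "nat \<Rightarrow> nat set \<Rightarrow> config set" where
  "basis d X = X \<rightarrow>\<^sub>E {..<d}"

definition normalized :: "nat \<Rightarrow> nat set \<Rightarrow> state_vec \<Rightarrow> bool" where
  "normalized d X \<phi> \<longleftrightarrow> (\<Sum>x\<in>basis d X. (cmod (\<phi> x))\<^sup>2) = 1"

definition ketbra :: "state_vec \<Rightarrow> operator" where
  "ketbra \<phi> = (\<lambda>x x'. \<phi> x * cnj (\<phi> x'))"

definition op_mult :: "nat \<Rightarrow> nat set \<Rightarrow> operator \<Rightarrow> operator \<Rightarrow> operator" where
  "op_mult d X \<rho> \<sigma> = (\<lambda>x x'. \<Sum>z\<in>basis d X. \<rho> x z * \<sigma> z x')"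

definition op_trace :: "nat \<Rightarrow> nat set \<Rightarrow> operator \<Rightarrow> complex" where
  "op_trace d X \<rho> = (\<Sum>x\<in>basis d X. \<rho> x x)"

text \<open>\<open>ptrace d X Y \<rho>\<close> is the operator on \<open>X\<close> obtained from the operator \<open>\<rho>\<close> on \<open>X \<union> Y\<close> by tracing
  out \<open>Y\<close>; it is meant for disjoint \<open>X\<close> and \<open>Y\<close>.\<close>

definition ptrace :: "nat \<Rightarrow> nat set \<Rightarrow> nat set \<Rightarrow> operator \<Rightarrow> operator" where
  "ptrace d X Y \<rho> = (\<lambda>x x'. \<Sum>y\<in>basis d Y. \<rho> (merge X Y (x, y)) (merge X Y (x', y)))"

text \<open>In all bipartite notions below, \<open>X\<close> and \<open>Y\<close> are the two sides of the cut. The trace under the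
  square root is real, so that taking the real part only adjusts the type.\<close>

definition pure_concurrence :: "nat \<Rightarrow> nat set \<Rightarrow> nat set \<Rightarrow> state_vec \<Rightarrow> real" where
  "pure_concurrence d X Y \<phi> =
    (let \<rho>X = ptrace d X Y (ketbra \<phi>)
     in sqrt (2 * (1 - Re (op_trace d X (op_mult d X \<rho>X \<rho>X)))))"

definition pure_decomposition ::
  "nat \<Rightarrow> nat set \<Rightarrow> operator \<Rightarrow> nat \<Rightarrow> (nat \<Rightarrow> real) \<Rightarrow> (nat \<Rightarrow> state_vec) \<Rightarrow> bool" where
  "pure_decomposition d Z \<rho> N p \<phi> \<longleftrightarrow>
     (\<forall>k<N. 0 \<le> p k) \<and> (\<Sum>k<N. p k) = 1 \<and> (\<forall>k<N. normalized d Z (\<phi> k)) \<and>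
     (\<forall>x\<in>basis d Z. \<forall>x'\<in>basis d Z.
        \<rho> x x' = (\<Sum>k<N. complex_of_real (p k) * ketbra (\<phi> k) x x'))"

definition average_concurrences :: "nat \<Rightarrow> nat set \<Rightarrow> nat set \<Rightarrow> operator \<Rightarrow> real set" where
  "average_concurrences d X Y \<rho> =
     {(\<Sum>k<N. p k * pure_concurrence d X Y (\<phi> k)) | N p \<phi>.
        pure_decomposition d (X \<union> Y) \<rho> N p \<phi>}"

text \<open>Least and greatest elements rather than infimum and supremum: an equation about these values
  can only be derived if the extrema are attained.\<close>

definition concurrence :: "nat \<Rightarrow> nat set \<Rightarrow> nat set \<Rightarrow> operator \<Rightarrow> real" where
  "concurrence d X Y \<rho> = (LEAST c. c \<in> average_concurrences d X Y \<rho>)"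

definition concurrence_of_assistance :: "nat \<Rightarrow> nat set \<Rightarrow> nat set \<Rightarrow> operator \<Rightarrow> real" where
  "concurrence_of_assistance d X Y \<rho> = (GREATEST c. c \<in> average_concurrences d X Y \<rho>)"

definition reduced_state :: "nat \<Rightarrow> nat set \<Rightarrow> nat set \<Rightarrow> operator \<Rightarrow> operator" where
  "reduced_state d S Z \<rho> = ptrace d Z (S - Z) \<rho>"

definition C_cut :: "nat \<Rightarrow> nat set \<Rightarrow> state_vec \<Rightarrow> nat set \<Rightarrow> nat set \<Rightarrow> real" where
  "C_cut d S \<psi> X Y = concurrence d X Y (reduced_state d S (X \<union> Y) (ketbra \<psi>))"

definition Ca_cut :: "nat \<Rightarrow> nat set \<Rightarrow> state_vec \<Rightarrow> nat set \<Rightarrow> nat set \<Rightarrow> real" where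
  "Ca_cut d S \<psi> X Y = concurrence_of_assistance d X Y (reduced_state d S (X \<union> Y) (ketbra \<psi>))"

definition ket :: "config \<Rightarrow> state_vec" where
  "ket x = (\<lambda>y. if y = x then 1 else 0)"

text \<open>The configuration \<open>0...0 i 0...0\<close> with \<open>i\<close> in position \<open>s\<close>.\<close>

definition single :: "nat \<Rightarrow> nat \<Rightarrow> nat \<Rightarrow> config" where
  "single n s i = (\<lambda>t\<in>{1..n}. if t = s then i else 0)"

definition W_state :: "nat \<Rightarrow> nat \<Rightarrow> (nat \<Rightarrow> nat \<Rightarrow> complex) \<Rightarrow> state_vec" where
  "W_state n d a = (\<lambda>x. \<Sum>i\<in>{1..<d}. \<Sum>s\<in>{1..n}. a s i * ket (single n s i) x)"

text \<open>On a pure state of the whole cut system, the mixed-state quantities reduce to the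
  pure-state concurrence, so the two readings of the concurrence of a pure state agree.\<close>

lemma finite_basis: "finite X \<Longrightarrow> finite (basis d X)"
  unfolding basis_def by (intro finite_PiE) auto

lemma merge_in_basis:
  "X \<inter> Y = {} \<Longrightarrow> x \<in> basis d X \<Longrightarrow> y \<in> basis d Y \<Longrightarrow> merge X Y (x, y) \<in> basis d (X \<union> Y)"
  unfolding basis_def merge_def PiE_def Pi_def extensional_def by auto

lemma pure_concurrence_cong:
  assumes "X \<inter> Y = {}"
    and "\<And>z z'. z \<in> basis d (X \<union> Y) \<Longrightarrow> z' \<in> basis d (X \<union> Y) \<Longrightarrow> ketbra \<phi> z z' = ketbra \<psi> z z'"
  shows "pure_concurrence d X Y \<phi> = pure_concurrence d X Y \<psi>"
proof -
  have "ptrace d X Y (ketbra \<phi>) x x' = ptrace d X Y (ketbra \<psi>) x x'"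
    if "x \<in> basis d X" "x' \<in> basis d X" for x x'
    unfolding ptrace_def using that assms by (intro sum.cong refl assms(2) merge_in_basis)
  then have "op_trace d X (op_mult d X (ptrace d X Y (ketbra \<phi>)) (ptrace d X Y (ketbra \<phi>)))
      = op_trace d X (op_mult d X (ptrace d X Y (ketbra \<psi>)) (ptrace d X Y (ketbra \<psi>)))"
    unfolding op_trace_def op_mult_def by (intro sum.cong refl) simp
  then show ?thesis
    unfolding pure_concurrence_def Let_def by simp
qed

lemma pure_decomposition_ketbra:
  assumes fin: "finite Z" and norm: "normalized d Z \<psi>"
    and dec: "pure_decomposition d Z (ketbra \<psi>) N p \<phi>"
    and k: "k < N" "p k \<noteq> 0"
    and z: "z \<in> basis d Z" "z' \<in> basis d Z"
  shows "ketbra (\<phi> k) z z' = ketbra \<psi> z z'"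
proof -
  let ?B = "basis d Z"
  define c where "c j = (\<Sum>x\<in>?B. cnj (\<psi> x) * \<phi> j x)" for j
  have pos: "\<And>j. j < N \<Longrightarrow> 0 \<le> p j" and sum1: "(\<Sum>j<N. p j) = 1"
    and nrm: "\<And>j. j < N \<Longrightarrow> normalized d Z (\<phi> j)"
    and eq: "\<And>x x'. x \<in> ?B \<Longrightarrow> x' \<in> ?B \<Longrightarrow>
      \<psi> x * cnj (\<psi> x') = (\<Sum>j<N. complex_of_real (p j) * (\<phi> j x * cnj (\<phi> j x')))"
    using dec unfolding pure_decomposition_def ketbra_def by auto
  have N\<psi>: "(\<Sum>x\<in>?B. \<psi> x * cnj (\<psi> x)) = 1"
    using norm unfolding normalized_def
    by (simp only: complex_norm_square[symmetric] of_real_sum[symmetric] of_real_1)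
  have N\<phi>: "(\<Sum>x\<in>?B. \<phi> j x * cnj (\<phi> j x)) = 1" if "j < N" for j
    using nrm[OF that] unfolding normalized_def
    by (simp only: complex_norm_square[symmetric] of_real_sum[symmetric] of_real_1)
  have dist: "(\<Sum>x\<in>?B. (cmod (\<phi> j x - c j * \<psi> x))\<^sup>2) = 1 - (cmod (c j))\<^sup>2" if "j < N" for j
  proof -
    have cc: "cnj (c j) = (\<Sum>x\<in>?B. \<psi> x * cnj (\<phi> j x))"
      unfolding c_def by simp
    have "complex_of_real (\<Sum>x\<in>?B. (cmod (\<phi> j x - c j * \<psi> x))\<^sup>2)
        = (\<Sum>x\<in>?B. (\<phi> j x - c j * \<psi> x) * cnj (\<phi> j x - c j * \<psi> x))"
      by (simp only: of_real_sum complex_norm_square)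
    also have "\<dots> = (\<Sum>x\<in>?B. \<phi> j x * cnj (\<phi> j x) - c j * (\<psi> x * cnj (\<phi> j x))
        - cnj (c j) * (cnj (\<psi> x) * \<phi> j x) + c j * cnj (c j) * (\<psi> x * cnj (\<psi> x)))"
      by (intro sum.cong refl) (simp add: algebra_simps)
    also have "\<dots> = 1 - c j * cnj (c j) - cnj (c j) * c j + c j * cnj (c j) * 1"
      unfolding sum.distrib sum_subtractf sum_distrib_left[symmetric] cc[symmetric] c_def[symmetric]
        N\<psi> N\<phi>[OF that] ..
    also have "\<dots> = complex_of_real (1 - (cmod (c j))\<^sup>2)"
      by (simp add: complex_norm_square del: of_real_power)
    finally show ?thesis using of_real_eq_iff by blast
  qed
  have "complex_of_real (\<Sum>j<N. p j * (cmod (c j))\<^sup>2)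
      = (\<Sum>j<N. complex_of_real (p j) * (c j * cnj (c j)))"
    by (simp add: complex_norm_square del: of_real_power)
  also have "\<dots> = (\<Sum>j<N. \<Sum>x\<in>?B. \<Sum>x'\<in>?B.
      complex_of_real (p j) * (\<phi> j x * cnj (\<phi> j x')) * (cnj (\<psi> x) * \<psi> x'))"
    unfolding c_def by (simp add: sum_product sum_distrib_left mult_ac)
  also have "\<dots> = (\<Sum>x\<in>?B. \<Sum>j<N. \<Sum>x'\<in>?B.
      complex_of_real (p j) * (\<phi> j x * cnj (\<phi> j x')) * (cnj (\<psi> x) * \<psi> x'))"
    by (rule sum.swap)
  also have "\<dots> = (\<Sum>x\<in>?B. \<Sum>x'\<in>?B. \<Sum>j<N.
      complex_of_real (p j) * (\<phi> j x * cnj (\<phi> j x')) * (cnj (\<psi> x) * \<psi> x'))"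
    by (intro sum.cong refl sum.swap)
  also have "\<dots> = (\<Sum>x\<in>?B. \<Sum>x'\<in>?B. \<psi> x * cnj (\<psi> x') * (cnj (\<psi> x) * \<psi> x'))"
    by (intro sum.cong refl) (simp add: eq sum_distrib_right)
  also have "\<dots> = (\<Sum>x\<in>?B. \<psi> x * cnj (\<psi> x)) * (\<Sum>x'\<in>?B. \<psi> x' * cnj (\<psi> x'))"
    by (simp add: sum_product mult_ac)
  finally have "complex_of_real (\<Sum>j<N. p j * (cmod (c j))\<^sup>2) = complex_of_real 1"
    by (simp only: N\<psi> mult_1 of_real_1)
  then have "(\<Sum>j<N. p j * (cmod (c j))\<^sup>2) = 1"
    by (simp only: of_real_eq_iff)
  then have "(\<Sum>j<N. p j * (1 - (cmod (c j))\<^sup>2)) = 0"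
    using sum1 by (simp add: right_diff_distrib sum_subtractf)
  moreover have nonneg: "0 \<le> p j * (1 - (cmod (c j))\<^sup>2)" if "j < N" for j
    using pos[OF that] dist[OF that]
    by (metis (no_types, lifting) mult_nonneg_nonneg sum_nonneg zero_le_power2)
  ultimately have "p k * (1 - (cmod (c k))\<^sup>2) = 0"
    using k(1) by (subst (asm) sum_nonneg_eq_0_iff) auto
  then have c1: "(cmod (c k))\<^sup>2 = 1" using k(2) by simp
  then have "\<forall>x\<in>?B. (cmod (\<phi> k x - c k * \<psi> x))\<^sup>2 = 0"
    using dist[OF k(1)] sum_nonneg_eq_0_iff[OF finite_basis[OF fin],
      where f = "\<lambda>x. (cmod (\<phi> k x - c k * \<psi> x))\<^sup>2"]
    by simp
  then have \<phi>: "\<phi> k x = c k * \<psi> x" if "x \<in> ?B" for x using that by simp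
  have "c k * cnj (c k) = 1"
    using c1 by (metis complex_norm_square of_real_1)
  then show ?thesis
    unfolding ketbra_def \<phi>[OF z(1)] \<phi>[OF z(2)] by (simp add: mult_ac)
qed

lemma average_concurrences_ketbra:
  assumes "finite X" "finite Y" "X \<inter> Y = {}" "normalized d (X \<union> Y) \<psi>"
  shows "average_concurrences d X Y (ketbra \<psi>) = {pure_concurrence d X Y \<psi>}"
proof (intro equalityI subsetI)
  fix c assume "c \<in> average_concurrences d X Y (ketbra \<psi>)"
  then obtain N p \<phi> where dec: "pure_decomposition d (X \<union> Y) (ketbra \<psi>) N p \<phi>"
    and c: "c = (\<Sum>k<N. p k * pure_concurrence d X Y (\<phi> k))"
    unfolding average_concurrences_def by blast
  have "p k * pure_concurrence d X Y (\<phi> k) = p k * pure_concurrence d X Y \<psi>" if "k < N" for k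
  proof (cases "p k = 0")
    case False
    have "pure_concurrence d X Y (\<phi> k) = pure_concurrence d X Y \<psi>"
      using assms False that
      by (intro pure_concurrence_cong pure_decomposition_ketbra[OF _ _ dec]) auto
    then show ?thesis by simp
  qed simp
  then have "c = (\<Sum>k<N. p k) * pure_concurrence d X Y \<psi>"
    unfolding c sum_distrib_right by (intro sum.cong refl) simp
  then show "c \<in> {pure_concurrence d X Y \<psi>}"
    using dec unfolding pure_decomposition_def by simp
next
  fix c assume "c \<in> {pure_concurrence d X Y \<psi>}"
  then have "c = (\<Sum>k<1::nat. 1 * pure_concurrence d X Y \<psi>)" by simp
  moreover have "pure_decomposition d (X \<union> Y) (ketbra \<psi>) 1 (\<lambda>_. 1) (\<lambda>_. \<psi>)"
    using assms(4) unfolding pure_decomposition_def by simp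
  ultimately show "c \<in> average_concurrences d X Y (ketbra \<psi>)"
    unfolding average_concurrences_def mem_Collect_eq
    by (intro exI[of _ "1::nat"] exI[of _ "\<lambda>_. 1::real"] exI[of _ "\<lambda>_. \<psi>"] conjI)
qed

lemma concurrence_ketbra:
  assumes "finite X" "finite Y" "X \<inter> Y = {}" "normalized d (X \<union> Y) \<psi>"
  shows "concurrence d X Y (ketbra \<psi>) = pure_concurrence d X Y \<psi>"
    and "concurrence_of_assistance d X Y (ketbra \<psi>) = pure_concurrence d X Y \<psi>"
  unfolding concurrence_def concurrence_of_assistance_def average_concurrences_ketbra[OF assms]
  by (auto intro: Least_equality Greatest_equality)

lemma reduced_state_whole:
  assumes "x \<in> basis d S" "x' \<in> basis d S"
  shows "reduced_state d S S \<rho> x x' = \<rho> x x'"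
proof -
  have "merge S {} (z, y) = z" if "z \<in> basis d S" for z y
    using that unfolding basis_def merge_def PiE_def extensional_def by auto
  then show ?thesis
    unfolding reduced_state_def ptrace_def using assms by (simp add: basis_def)
qed

lemma average_concurrences_cong:
  assumes "\<And>z z'. z \<in> basis d (X \<union> Y) \<Longrightarrow> z' \<in> basis d (X \<union> Y) \<Longrightarrow> \<rho> z z' = \<sigma> z z'"
  shows "average_concurrences d X Y \<rho> = average_concurrences d X Y \<sigma>"
  unfolding average_concurrences_def pure_decomposition_def using assms by auto

lemma C_cut_whole:
  assumes "finite X" "finite Y" "X \<inter> Y = {}" "normalized d (X \<union> Y) \<psi>"
  shows "C_cut d (X \<union> Y) \<psi> X Y = pure_concurrence d X Y \<psi>"
    and "Ca_cut d (X \<union> Y) \<psi> X Y = pure_concurrence d X Y \<psi>"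
proof -
  have "average_concurrences d X Y (reduced_state d (X \<union> Y) (X \<union> Y) (ketbra \<psi>))
      = average_concurrences d X Y (ketbra \<psi>)"
    by (intro average_concurrences_cong reduced_state_whole)
  then show "C_cut d (X \<union> Y) \<psi> X Y = pure_concurrence d X Y \<psi>"
    and "Ca_cut d (X \<union> Y) \<psi> X Y = pure_concurrence d X Y \<psi>"
    using concurrence_ketbra[OF assms]
    unfolding C_cut_def Ca_cut_def concurrence_def concurrence_of_assistance_def by simp_all
qed

end

theory Submission
  imports Defs
begin

text \<open>
  The reduced state of \<open>W\<close> on \<open>X \<union> Y\<close> is \<open>|w\<rangle>\<langle>w| + q |0\<rangle>\<langle>0|\<close>, where \<open>w\<close> is the W-class vector built
  from the amplitudes in \<open>X \<union> Y\<close>. Hence every vector \<open>\<phi>\<^sub>k\<close> of a pure decomposition has the form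
  \<open>u\<^sub>k w + v\<^sub>k |0\<rangle>\<close>, and its concurrence is \<open>2 |u\<^sub>k|\<^sup>2 sqrt (\<alpha>\<^sub>X \<alpha>\<^sub>Y)\<close>, where \<open>\<alpha>\<^sub>X\<close> and \<open>\<alpha>\<^sub>Y\<close> are the squared
  norms of the amplitudes in \<open>X\<close> and \<open>Y\<close>. If \<open>w \<noteq> 0\<close>, comparing the coefficients of \<open>|w\<rangle>\<langle>w|\<close> gives
  \<open>\<Sum>\<^sub>k p\<^sub>k |u\<^sub>k|\<^sup>2 = 1\<close>, and otherwise \<open>\<alpha>\<^sub>X = 0\<close>, so that all decompositions have the same average concurrence
  \<open>2 sqrt (\<alpha>\<^sub>X \<alpha>\<^sub>Y)\<close>. The square \<open>4 \<alpha>\<^sub>X \<alpha>\<^sub>Y\<close> is additive in \<open>Y\<close>.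
\<close>

section \<open>W-class vectors on arbitrary sets of subsystems\<close>

definition excite :: "nat set \<Rightarrow> nat \<Rightarrow> nat \<Rightarrow> config" where
  "excite Z s i = (\<lambda>t\<in>Z. if t = s then i else 0)"

definition vac :: "nat set \<Rightarrow> config" where
  "vac Z = (\<lambda>t\<in>Z. 0)"

text \<open>Not normalized in general: on a proper part \<open>Z\<close> of the system it is the
  component of the W state in which the excitation sits in \<open>Z\<close>.\<close>

definition W_on :: "nat \<Rightarrow> (nat \<Rightarrow> nat \<Rightarrow> complex) \<Rightarrow> nat set \<Rightarrow> state_vec" where
  "W_on d a Z = (\<lambda>x. \<Sum>s\<in>Z. \<Sum>i\<in>{1..<d}. a s i * ket (excite Z s i) x)"

text \<open>For finite \<open>Z\<close> this is the squared norm of \<open>W_on d a Z\<close>, by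
  \<open>sum_W_on\<close>. Written as a sum over sites, it is visibly additive over disjoint
  sets.\<close>

definition weight :: "nat \<Rightarrow> (nat \<Rightarrow> nat \<Rightarrow> complex) \<Rightarrow> nat set \<Rightarrow> real" where
  "weight d a Z = (\<Sum>s\<in>Z. \<Sum>i\<in>{1..<d}. (cmod (a s i))\<^sup>2)"

lemma weight_nonneg: "0 \<le> weight d a Z"
  unfolding weight_def by (intro sum_nonneg) auto

lemma W_state_eq: "W_state n d a = W_on d a {1..n}"
  unfolding W_state_def W_on_def single_def excite_def by (intro ext sum.swap)

lemma vac_in_basis: "0 < d \<Longrightarrow> vac Z \<in> basis d Z"
  unfolding vac_def basis_def by auto

section \<open>Product basis of a bipartite system\<close>

lemma restrict_merge_left:
  assumes "x \<in> basis d X"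
  shows "restrict (merge X Y (x, y)) X = x"
  using assms unfolding merge_def basis_def PiE_def extensional_def by auto

lemma restrict_merge_right:
  assumes "X \<inter> Y = {}" "y \<in> basis d Y"
  shows "restrict (merge X Y (x, y)) Y = y"
  using assms unfolding merge_def basis_def PiE_def extensional_def by fastforce

lemma merge_restrict:
  assumes "z \<in> basis d (X \<union> Y)"
  shows "merge X Y (restrict z X, restrict z Y) = z"
  using assms unfolding merge_def basis_def PiE_def extensional_def by auto

lemma merge_eq_iff:
  assumes "X \<inter> Y = {}" "x \<in> basis d X" "y \<in> basis d Y" "x' \<in> basis d X" "y' \<in> basis d Y"
  shows "merge X Y (x, y) = merge X Y (x', y') \<longleftrightarrow> x = x' \<and> y = y'"
  using assms restrict_merge_left restrict_merge_right by metis

lemma bij_betw_merge: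
  assumes "X \<inter> Y = {}"
  shows "bij_betw (merge X Y) (basis d X \<times> basis d Y) (basis d (X \<union> Y))"
proof (rule bij_betw_byWitness[where f' = "\<lambda>z. (restrict z X, restrict z Y)"])
  show "\<forall>w\<in>basis d X \<times> basis d Y. (restrict (merge X Y w) X, restrict (merge X Y w) Y) = w"
    by (auto simp: restrict_merge_left restrict_merge_right[OF assms])
  show "\<forall>z\<in>basis d (X \<union> Y). merge X Y (restrict z X, restrict z Y) = z"
    by (intro ballI merge_restrict)
  show "merge X Y ` (basis d X \<times> basis d Y) \<subseteq> basis d (X \<union> Y)"
    using merge_in_basis[OF assms] by auto
  show "(\<lambda>z. (restrict z X, restrict z Y)) ` basis d (X \<union> Y) \<subseteq> basis d X \<times> basis d Y"
    unfolding basis_def by (auto simp: restrict_PiE_iff)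
qed

lemma sum_basis_Un:
  assumes "X \<inter> Y = {}"
  shows "(\<Sum>z\<in>basis d (X \<union> Y). h z) = (\<Sum>x\<in>basis d X. \<Sum>y\<in>basis d Y. h (merge X Y (x, y)))"
  unfolding sum.cartesian_product sum.reindex_bij_betw[OF bij_betw_merge[OF assms], symmetric]
  by (simp add: case_prod_unfold)

lemma excite_in_basis: "i < d \<Longrightarrow> excite Z s i \<in> basis d Z"
  unfolding excite_def basis_def by auto

lemma vac_Un: "vac (X \<union> Y) = merge X Y (vac X, vac Y)"
  by (rule ext) (simp add: vac_def merge_def)

lemma excite_Un_left: "X \<inter> Y = {} \<Longrightarrow> s \<in> X \<Longrightarrow> excite (X \<union> Y) s i = merge X Y (excite X s i, vac Y)"
  by (rule ext) (auto simp: excite_def vac_def merge_def)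

lemma excite_Un_right: "X \<inter> Y = {} \<Longrightarrow> s \<in> Y \<Longrightarrow> excite (X \<union> Y) s i = merge X Y (vac X, excite Y s i)"
  by (rule ext) (auto simp: excite_def vac_def merge_def)

lemma excite_neq_vac: "s \<in> Z \<Longrightarrow> i \<noteq> 0 \<Longrightarrow> excite Z s i \<noteq> vac Z"
  unfolding excite_def vac_def by (auto dest: fun_cong[of _ _ s])

lemma excite_eq_iff:
  assumes "s \<in> Z" "s' \<in> Z" "i \<noteq> 0"
  shows "excite Z s i = excite Z s' i' \<longleftrightarrow> s = s' \<and> i = i'"
  using assms unfolding excite_def by (auto dest: fun_cong[of _ _ s] split: if_splits)

lemma W_on_vac: "W_on d a Z (vac Z) = 0"
  unfolding W_on_def ket_def by (intro sum.neutral ballI) (simp add: excite_neq_vac[symmetric])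

text \<open>A single excitation sits on one side of the cut and leaves the other side in its vacuum.
  The resulting star shape is all that the partial traces below rely on. The case
  \<open>d = 0\<close> is separate because \<open>vac\<close> is a basis label only for
  \<open>0 < d\<close>.\<close>

lemma W_on_merge:
  assumes XY: "X \<inter> Y = {}" "finite X" "finite Y"
    and x: "x \<in> basis d X" and y: "y \<in> basis d Y"
  shows "W_on d a (X \<union> Y) (merge X Y (x, y))
    = W_on d a X x * ket (vac Y) y + ket (vac X) x * W_on d a Y y"
proof (cases "0 < d")
  case True
  have l: "ket (excite (X \<union> Y) s i) (merge X Y (x, y)) = ket (excite X s i) x * ket (vac Y) y"
    if "s \<in> X" "i \<in> {1..<d}" for s i
    using merge_eq_iff[OF XY(1) x y excite_in_basis vac_in_basis, of i s] that(2) True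
    unfolding excite_Un_left[OF XY(1) that(1)] ket_def by simp
  have r: "ket (excite (X \<union> Y) s i) (merge X Y (x, y)) = ket (vac X) x * ket (excite Y s i) y"
    if "s \<in> Y" "i \<in> {1..<d}" for s i
    using merge_eq_iff[OF XY(1) x y vac_in_basis excite_in_basis, of i s] that(2) True
    unfolding excite_Un_right[OF XY(1) that(1)] ket_def by simp
  have "W_on d a (X \<union> Y) (merge X Y (x, y))
      = (\<Sum>s\<in>X. \<Sum>i\<in>{1..<d}. a s i * (ket (excite X s i) x * ket (vac Y) y))
      + (\<Sum>s\<in>Y. \<Sum>i\<in>{1..<d}. a s i * (ket (vac X) x * ket (excite Y s i) y))"
    unfolding W_on_def sum.union_disjoint[OF XY(2,3,1)]
    by (intro arg_cong2[of _ _ _ _ "(+)"] sum.cong refl) (auto simp: l r)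
  then show ?thesis
    unfolding W_on_def by (simp add: sum_distrib_left sum_distrib_right mult_ac)
qed (simp add: W_on_def)

lemma sum_ket:
  assumes "finite B" "x \<in> B"
  shows "(\<Sum>z\<in>B. h z * ket x z) = h x"
  using assms unfolding ket_def by (simp add: if_distrib if_distribR cong: if_cong)

text \<open>Different pairs of a site and a nonzero level give different basis labels, so each
  amplitude occurs at exactly one label and no cross terms arise.\<close>

lemma sum_W_on:
  assumes "finite Z"
  shows "(\<Sum>x\<in>basis d Z. (cmod (W_on d a Z x))\<^sup>2) = weight d a Z"
proof -
  let ?I = "Z \<times> {1..<d}"
  let ?e = "\<lambda>(s, i). excite Z s i"
  have inj: "inj_on ?e ?I"
    by (auto simp: inj_on_def excite_eq_iff)
  have val: "W_on d a Z (?e w) = (case w of (s, i) \<Rightarrow> a s i)" if w: "w \<in> ?I" for w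
  proof -
    have "W_on d a Z (?e w) = (\<Sum>v\<in>?I. (case v of (s, i) \<Rightarrow> a s i) * ket (?e v) (?e w))"
      unfolding W_on_def sum.cartesian_product by (simp add: case_prod_unfold)
    also have "\<dots> = (\<Sum>v\<in>?I. (case v of (s, i) \<Rightarrow> a s i) * (if v = w then 1 else 0))"
      using inj_on_eq_iff[OF inj w] by (intro sum.cong refl) (simp add: ket_def)
    finally show ?thesis using w assms by (simp add: if_distrib if_distribR cong: if_cong)
  qed
  have zero: "W_on d a Z x = 0" if "x \<notin> ?e ` ?I" for x
    using that unfolding W_on_def ket_def by (intro sum.neutral ballI) auto
  have "(\<Sum>x\<in>basis d Z. (cmod (W_on d a Z x))\<^sup>2) = (\<Sum>x\<in>?e ` ?I. (cmod (W_on d a Z x))\<^sup>2)"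
    using assms zero by (intro sum.mono_neutral_right finite_basis) (auto intro: excite_in_basis)
  also have "\<dots> = (\<Sum>w\<in>?I. (cmod (case w of (s, i) \<Rightarrow> a s i))\<^sup>2)"
    unfolding sum.reindex[OF inj] by (intro sum.cong refl) (simp only: o_def val)
  finally show ?thesis
    unfolding weight_def sum.cartesian_product by (simp add: case_prod_unfold)
qed

section \<open>Concurrence of star-shaped pure states\<close>

text \<open>No cross terms survive: at \<open>y = vac Y\<close> only \<open>f\<close> contributes
  because \<open>g\<close> vanishes there, and at every other \<open>y\<close> only \<open>g\<close>
  does, with \<open>X\<close> in its vacuum.\<close>

lemma ptrace_star:
  assumes Y: "finite Y" "0 < d" and x: "x \<in> basis d X" "x' \<in> basis d X"
    and \<phi>: "\<And>x y. x \<in> basis d X \<Longrightarrow> y \<in> basis d Y \<Longrightarrow>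
      \<phi> (merge X Y (x, y)) = f x * ket (vac Y) y + ket (vac X) x * g y"
    and g: "g (vac Y) = 0"
  shows "ptrace d X Y (ketbra \<phi>) x x' = f x * cnj (f x')
    + ket (vac X) x * ket (vac X) x' * complex_of_real (\<Sum>y\<in>basis d Y. (cmod (g y))\<^sup>2)"
proof -
  have "ptrace d X Y (ketbra \<phi>) x x' = (\<Sum>y\<in>basis d Y. f x * cnj (f x') * ket (vac Y) y
      + ket (vac X) x * ket (vac X) x' * complex_of_real ((cmod (g y))\<^sup>2))"
    unfolding ptrace_def ketbra_def
    by (intro sum.cong refl) (auto simp: \<phi> x g ket_def complex_norm_square simp del: of_real_power)
  then show ?thesis
    using Y by (simp add: sum.distrib sum_distrib_left sum_ket finite_basis vac_in_basis)
qed

text \<open>The reduced operator is |f><f| + \<beta> |0><0|. Normalization turns the trace of its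
  square into 1 - 2 \<alpha> \<beta>, from which the vacuum amplitude of \<open>f\<close> has
  cancelled.\<close>

lemma pure_concurrence_star:
  assumes XY: "finite X" "finite Y" "X \<inter> Y = {}" "0 < d"
    and norm: "normalized d (X \<union> Y) \<phi>"
    and \<phi>: "\<And>x y. x \<in> basis d X \<Longrightarrow> y \<in> basis d Y \<Longrightarrow>
      \<phi> (merge X Y (x, y)) = f x * ket (vac Y) y + ket (vac X) x * g y"
    and g: "g (vac Y) = 0"
  shows "pure_concurrence d X Y \<phi> = 2 * sqrt ((\<Sum>x\<in>basis d X - {vac X}. (cmod (f x))\<^sup>2)
    * (\<Sum>y\<in>basis d Y. (cmod (g y))\<^sup>2))"
proof -
  let ?B = "basis d X"
  define \<alpha> where "\<alpha> = (\<Sum>x\<in>?B - {vac X}. (cmod (f x))\<^sup>2)"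
  define \<beta> where "\<beta> = (\<Sum>y\<in>basis d Y. (cmod (g y))\<^sup>2)"
  define \<gamma> where "\<gamma> = (cmod (f (vac X)))\<^sup>2"
  define \<rho> where "\<rho> = ptrace d X Y (ketbra \<phi>)"
  have fin: "finite ?B" and vac: "vac X \<in> ?B"
    using XY by (auto intro: finite_basis vac_in_basis)
  have \<rho>: "\<rho> x x' = f x * cnj (f x') + ket (vac X) x * ket (vac X) x' * complex_of_real \<beta>"
    if "x \<in> ?B" "x' \<in> ?B" for x x'
    unfolding \<rho>_def \<beta>_def using ptrace_star[OF XY(2,4) that \<phi> g] .
  have F: "(\<Sum>x\<in>?B. f x * cnj (f x)) = complex_of_real (\<alpha> + \<gamma>)"
    unfolding \<alpha>_def \<gamma>_def complex_norm_square[symmetric] of_real_sum[symmetric]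
    using sum.remove[OF fin vac, of "\<lambda>x. (cmod (f x))\<^sup>2"] by simp
  \<comment> \<open>Normalization of \<phi> is read as tr \<rho> = 1, so that the explicit form of
    \<rho> relates \<alpha>, \<beta> and \<gamma>.\<close>
  have "complex_of_real 1 = (\<Sum>z\<in>basis d (X \<union> Y). complex_of_real ((cmod (\<phi> z))\<^sup>2))"
    using norm unfolding normalized_def of_real_sum[symmetric] by simp
  also have "\<dots> = (\<Sum>x\<in>?B. \<rho> x x)"
    unfolding sum_basis_Un[OF XY(3)] \<rho>_def ptrace_def ketbra_def complex_norm_square ..
  also have "\<dots> = (\<Sum>x\<in>?B. f x * cnj (f x) + complex_of_real \<beta> * ket (vac X) x)"
    by (intro sum.cong refl) (simp add: \<rho> ket_def)
  also have "\<dots> = complex_of_real (\<alpha> + \<gamma> + \<beta>)"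
    unfolding sum.distrib F sum_ket[OF fin vac] by simp
  finally have one: "\<alpha> + \<gamma> + \<beta> = 1"
    unfolding of_real_eq_iff by simp
  \<comment> \<open>The product is sorted by its vacuum factors: the first term factorizes into two
    traces, and in the others \<open>sum_ket\<close> collapses both sums.\<close>
  have "op_trace d X (op_mult d X \<rho> \<rho>) = (\<Sum>x\<in>?B. \<Sum>x'\<in>?B.
      f x * cnj (f x) * (f x' * cnj (f x'))
      + (f x * (cnj (f x') * \<beta>)) * ket (vac X) x' * ket (vac X) x
      + (f x' * (cnj (f x) * \<beta>)) * ket (vac X) x' * ket (vac X) x
      + complex_of_real (\<beta>\<^sup>2) * ket (vac X) x' * ket (vac X) x)"
    unfolding op_trace_def op_mult_def
    by (intro sum.cong refl) (auto simp: \<rho> ket_def algebra_simps power2_eq_square)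
  also have "\<dots> = complex_of_real ((\<alpha> + \<gamma>)\<^sup>2 + 2 * (\<gamma> * \<beta>) + \<beta>\<^sup>2)"
    unfolding sum.distrib sum_distrib_right[symmetric] sum_ket[OF fin vac]
      sum_product[symmetric] F
    by (simp add: \<gamma>_def complex_norm_square power2_eq_square[of "_ + _"] mult_ac del: of_real_power)
  finally have "Re (op_trace d X (op_mult d X \<rho> \<rho>)) = (\<alpha> + \<gamma>)\<^sup>2 + 2 * (\<gamma> * \<beta>) + \<beta>\<^sup>2"
    by simp
  also have "\<dots> = (\<alpha> + \<gamma> + \<beta>)\<^sup>2 - 2 * (\<alpha> * \<beta>)"
    by (simp add: power2_eq_square algebra_simps)
  finally have "pure_concurrence d X Y \<phi> = sqrt (2\<^sup>2 * (\<alpha> * \<beta>))"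
    unfolding pure_concurrence_def Let_def \<rho>_def[symmetric] one by simp
  then show ?thesis
    unfolding \<alpha>_def[symmetric] \<beta>_def[symmetric] real_sqrt_mult by simp
qed

section \<open>Reduced states of the W state and their decompositions\<close>

text \<open>An excitation in the traced-out part leaves \<open>Z\<close> in its vacuum, with
  probability \<open>weight d a (S - Z)\<close>; otherwise the excitation stays coherently in
  \<open>Z\<close>.\<close>

lemma reduced_W:
  assumes S: "finite S" "Z \<subseteq> S" "0 < d" and z: "z \<in> basis d Z" "z' \<in> basis d Z"
  shows "reduced_state d S Z (ketbra (W_on d a S)) z z'
    = W_on d a Z z * cnj (W_on d a Z z')
      + ket (vac Z) z * ket (vac Z) z' * complex_of_real (weight d a (S - Z))"
proof -
  have S_eq: "Z \<union> (S - Z) = S" using S by auto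
  have W: "W_on d a S (merge Z (S - Z) (x, y))
      = W_on d a Z x * ket (vac (S - Z)) y + ket (vac Z) x * W_on d a (S - Z) y"
    if "x \<in> basis d Z" "y \<in> basis d (S - Z)" for x y
    using W_on_merge[of Z "S - Z" x d y a] S that finite_subset[OF S(2,1)] unfolding S_eq by simp
  show ?thesis
    unfolding reduced_state_def sum_W_on[OF finite_Diff[OF S(1)], symmetric]
    using S z by (intro ptrace_star W_on_vac W) auto
qed

text \<open>Two-by-two minors suffice to see that \<open>\<phi>\<^sub>k\<close> is parallel to \<open>w\<close> away from \<open>z\<^sub>0\<close>: the form
  \<open>\<Sum>\<^sub>k p\<^sub>k |w(x') \<phi>\<^sub>k(x) - w(x) \<phi>\<^sub>k(x')|\<^sup>2\<close> is read off \<open>\<rho>\<close> and vanishes. If \<open>w = 0\<close>, these forms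
  say nothing, and \<open>\<Sum>\<^sub>k p\<^sub>k |\<phi>\<^sub>k(x)|\<^sup>2\<close> is used instead.\<close>

lemma pure_decomposition_parallel:
  assumes dec: "pure_decomposition d Z \<rho> N p \<phi>"
    and \<rho>: "\<And>x x'. x \<in> basis d Z - {z0} \<Longrightarrow> x' \<in> basis d Z - {z0} \<Longrightarrow> \<rho> x x' = w x * cnj (w x')"
    and k: "k < N" "p k \<noteq> 0"
  shows "\<exists>u. \<forall>x\<in>basis d Z - {z0}. \<phi> k x = u * w x"
proof -
  let ?B = "basis d Z - {z0}"
  have pos: "\<And>j. j < N \<Longrightarrow> 0 \<le> p j"
    and eq: "\<And>x x'. x \<in> ?B \<Longrightarrow> x' \<in> ?B \<Longrightarrow>
      (\<Sum>j<N. complex_of_real (p j) * (\<phi> j x * cnj (\<phi> j x'))) = w x * cnj (w x')"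
    using dec \<rho> unfolding pure_decomposition_def ketbra_def by auto
  \<comment> \<open>One weighted sum of squares serves both cases: \<open>s = w x'\<close>,
    \<open>t = w x\<close> give the minors, and \<open>s = 1\<close>, \<open>t = 0\<close> with
    equal arguments treat vanishing \<open>w\<close>.\<close>
  have form: "s * \<phi> k x = t * \<phi> k x'"
    if x: "x \<in> ?B" "x' \<in> ?B" and st: "s * w x = t * w x'" for s t x x'
  proof -
    have "complex_of_real (\<Sum>j<N. p j * (cmod (s * \<phi> j x - t * \<phi> j x'))\<^sup>2)
        = (\<Sum>j<N. complex_of_real (p j) * ((s * \<phi> j x - t * \<phi> j x') * cnj (s * \<phi> j x - t * \<phi> j x')))"
      unfolding of_real_sum of_real_mult complex_norm_square ..
    also have "\<dots> = (\<Sum>j<N. s * cnj s * (complex_of_real (p j) * (\<phi> j x * cnj (\<phi> j x)))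
        - s * cnj t * (complex_of_real (p j) * (\<phi> j x * cnj (\<phi> j x')))
        - t * cnj s * (complex_of_real (p j) * (\<phi> j x' * cnj (\<phi> j x)))
        + t * cnj t * (complex_of_real (p j) * (\<phi> j x' * cnj (\<phi> j x'))))"
      by (intro sum.cong refl) (simp add: algebra_simps)
    also have "\<dots> = s * cnj s * (w x * cnj (w x)) - s * cnj t * (w x * cnj (w x'))
        - t * cnj s * (w x' * cnj (w x)) + t * cnj t * (w x' * cnj (w x'))"
      unfolding sum.distrib sum_subtractf sum_distrib_left[symmetric] using x by (simp add: eq)
    also have "\<dots> = (s * w x - t * w x') * cnj (s * w x - t * w x')"
      by (simp add: algebra_simps)
    also have "\<dots> = complex_of_real 0" using st by simp
    finally have "(\<Sum>j<N. p j * (cmod (s * \<phi> j x - t * \<phi> j x'))\<^sup>2) = 0"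
      unfolding of_real_eq_iff .
    then have "p k * (cmod (s * \<phi> k x - t * \<phi> k x'))\<^sup>2 = 0"
      using k(1) pos by (subst (asm) sum_nonneg_eq_0_iff) auto
    then show ?thesis using k(2) by simp
  qed
  show ?thesis
  proof (cases "\<exists>x'\<in>?B. w x' \<noteq> 0")
    case True
    then obtain x' where x': "x' \<in> ?B" "w x' \<noteq> 0" by blast
    have "\<phi> k x = \<phi> k x' / w x' * w x" if "x \<in> ?B" for x
      using form[OF that x'(1), of "w x'" "w x"] x'(2) by (simp add: field_simps)
    then show ?thesis by blast
  next
    case False
    have "\<phi> k x = 0 * w x" if "x \<in> ?B" for x
      using form[OF that that, of 1 0] False that by simp
    then show ?thesis by blast
  qed
qed

text \<open>A singleton settles the minimum, the maximum and their attainment at once. Besides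
  evaluating every decomposition, the proof must therefore exhibit one.\<close>

lemma average_concurrences_W:
  assumes S: "finite S" "X \<subseteq> S" "Y \<subseteq> S" "X \<inter> Y = {}" "0 < d"
    and one: "weight d a S = 1"
  shows "average_concurrences d X Y (reduced_state d S (X \<union> Y) (ketbra (W_on d a S)))
    = {2 * sqrt (weight d a X * weight d a Y)}" (is "average_concurrences d X Y ?\<rho> = {?c}")
proof -
  define Z where "Z = X \<union> Y"
  define w where "w = W_on d a Z"
  define q where "q = weight d a (S - Z)"
  let ?B = "basis d Z"
  have fin: "finite X" "finite Y" "finite Z" "finite ?B"
    using finite_subset[OF S(2,1)] finite_subset[OF S(3,1)] unfolding Z_def
    by (simp_all add: finite_basis)
  have vac: "vac X \<in> basis d X" "vac Y \<in> basis d Y" "vac Z \<in> ?B"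
    using S by (auto intro: vac_in_basis)
  have \<rho>: "?\<rho> z z' = w z * cnj (w z') + ket (vac Z) z * ket (vac Z) z' * complex_of_real q"
    if "z \<in> ?B" "z' \<in> ?B" for z z'
    using reduced_W[of S Z d z z' a] that S unfolding Z_def w_def q_def by auto
  have wm: "w (merge X Y (x, y)) = W_on d a X x * ket (vac Y) y + ket (vac X) x * W_on d a Y y"
    if "x \<in> basis d X" "y \<in> basis d Y" for x y
    unfolding w_def Z_def using W_on_merge[OF S(4) fin(1,2) that] .
  have w0: "w (vac Z) = 0" unfolding w_def by (rule W_on_vac)
  have weights: "weight d a Z = weight d a X + weight d a Y"
    unfolding Z_def weight_def using S fin by (intro sum.union_disjoint) auto
  have total: "weight d a Z + q = 1"
    unfolding q_def one[symmetric] weight_def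
    using S sum.subset_diff[of Z S "\<lambda>s. \<Sum>i\<in>{1..<d}. (cmod (a s i))\<^sup>2"] by (simp add: Z_def)
  have avg: "(\<Sum>k<N. p k * pure_concurrence d X Y (\<phi> k)) = ?c"
    if dec: "pure_decomposition d Z ?\<rho> N p \<phi>" for N p \<phi>
  proof -
    have \<rho>': "?\<rho> x x' = w x * cnj (w x')" if "x \<in> ?B - {vac Z}" "x' \<in> ?B - {vac Z}" for x x'
      using that \<rho>[of x x'] by (simp add: ket_def)
    \<comment> \<open>Vectors of probability zero are unconstrained by the state; they drop out of
      the average, so \<open>u k\<close> may be arbitrary for them.\<close>
    have "\<forall>k. \<exists>u. k < N \<longrightarrow> p k \<noteq> 0 \<longrightarrow> (\<forall>x\<in>?B - {vac Z}. \<phi> k x = u * w x)"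
      using pure_decomposition_parallel[OF dec \<rho>'] by blast
    then obtain u where u: "\<And>k x. k < N \<Longrightarrow> p k \<noteq> 0 \<Longrightarrow> x \<in> ?B - {vac Z} \<Longrightarrow> \<phi> k x = u k * w x"
      by metis
    have conc: "pure_concurrence d X Y (\<phi> k) = (cmod (u k))\<^sup>2 * ?c" if k: "k < N" "p k \<noteq> 0" for k
    proof -
      \<comment> \<open>The amplitude at the joint vacuum is independent of \<open>u k\<close>. It
        is assigned to \<open>f\<close>, so that \<open>g (vac Y) = 0\<close> as
        \<open>pure_concurrence_star\<close> demands.\<close>
      define f where "f x = u k * W_on d a X x + \<phi> k (vac Z) * ket (vac X) x" for x
      define g where "g y = u k * W_on d a Y y" for y
      have form: "\<phi> k (merge X Y (x, y)) = f x * ket (vac Y) y + ket (vac X) x * g y"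
        if xy: "x \<in> basis d X" "y \<in> basis d Y" for x y
      proof (cases "merge X Y (x, y) = vac Z")
        case True
        then have "x = vac X" "y = vac Y"
          using merge_eq_iff[OF S(4) xy vac(1,2)] unfolding Z_def vac_Un by auto
        then show ?thesis using True unfolding f_def g_def by (simp add: W_on_vac ket_def)
      next
        case False
        then have "\<phi> k (merge X Y (x, y)) = u k * w (merge X Y (x, y))"
          using u[OF k] merge_in_basis[OF S(4) xy] unfolding Z_def by blast
        moreover have "ket (vac X) x * ket (vac Y) y = 0"
          using False unfolding Z_def vac_Un ket_def by auto
        ultimately show ?thesis
          unfolding f_def g_def wm[OF xy] by (auto simp: algebra_simps)
      qed
      have "(\<Sum>x\<in>basis d X - {vac X}. (cmod (f x))\<^sup>2)
          = (\<Sum>x\<in>basis d X - {vac X}. (cmod (u k))\<^sup>2 * (cmod (W_on d a X x))\<^sup>2)"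
        by (intro sum.cong refl) (auto simp: f_def ket_def norm_mult power_mult_distrib)
      \<comment> \<open>The vacuum label can be restored because \<open>W_on\<close> vanishes
        there.\<close>
      also have "\<dots> = (\<Sum>x\<in>basis d X. (cmod (u k))\<^sup>2 * (cmod (W_on d a X x))\<^sup>2)"
        using fin by (intro sum.mono_neutral_left finite_basis) (auto simp: W_on_vac)
      also have "\<dots> = (cmod (u k))\<^sup>2 * weight d a X"
        unfolding sum_distrib_left[symmetric] sum_W_on[OF fin(1)] ..
      finally have \<alpha>: "(\<Sum>x\<in>basis d X - {vac X}. (cmod (f x))\<^sup>2) = (cmod (u k))\<^sup>2 * weight d a X" .
      have \<beta>: "(\<Sum>y\<in>basis d Y. (cmod (g y))\<^sup>2) = (cmod (u k))\<^sup>2 * weight d a Y"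
        unfolding g_def norm_mult power_mult_distrib sum_distrib_left[symmetric] sum_W_on[OF fin(2)] ..
      have "normalized d (X \<union> Y) (\<phi> k)"
        using dec k(1) unfolding pure_decomposition_def Z_def by blast
      then have "pure_concurrence d X Y (\<phi> k)
          = 2 * sqrt ((cmod (u k))\<^sup>2 * weight d a X * ((cmod (u k))\<^sup>2 * weight d a Y))"
        using pure_concurrence_star[OF fin(1,2) S(4,5) _ form] \<alpha> \<beta>
        by (simp add: g_def W_on_vac)
      also have "(cmod (u k))\<^sup>2 * weight d a X * ((cmod (u k))\<^sup>2 * weight d a Y)
          = ((cmod (u k))\<^sup>2)\<^sup>2 * (weight d a X * weight d a Y)"
        by (simp add: power2_eq_square)
      finally show ?thesis
        unfolding real_sqrt_mult[of "((cmod (u k))\<^sup>2)\<^sup>2"] real_sqrt_abs by simp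
    qed
    have sum: "(\<Sum>k<N. p k * pure_concurrence d X Y (\<phi> k)) = (\<Sum>k<N. p k * (cmod (u k))\<^sup>2) * ?c"
      unfolding sum_distrib_right
    proof (intro sum.cong refl)
      fix k assume "k \<in> {..<N}"
      then show "p k * pure_concurrence d X Y (\<phi> k) = p k * (cmod (u k))\<^sup>2 * ?c"
        using conc[of k] by (cases "p k = 0") simp_all
    qed
    show ?thesis
    proof (cases "\<exists>x\<in>?B. w x \<noteq> 0")
      case True
      then obtain x where x: "x \<in> ?B" "w x \<noteq> 0" by blast
      then have x': "x \<in> ?B - {vac Z}" using w0 by auto
      have "w x * cnj (w x) = (\<Sum>k<N. complex_of_real (p k) * (\<phi> k x * cnj (\<phi> k x)))"
        using dec x(1) \<rho>'[OF x' x'] unfolding pure_decomposition_def ketbra_def by auto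
      also have "\<dots> = (\<Sum>k<N. complex_of_real (p k * (cmod (u k))\<^sup>2) * (w x * cnj (w x)))"
      proof (intro sum.cong refl)
        fix k assume "k \<in> {..<N}"
        then show "complex_of_real (p k) * (\<phi> k x * cnj (\<phi> k x))
            = complex_of_real (p k * (cmod (u k))\<^sup>2) * (w x * cnj (w x))"
          using u[of k x] x'
          by (cases "p k = 0") (simp_all add: complex_norm_square mult_ac del: of_real_power)
      qed
      also have "\<dots> = complex_of_real (\<Sum>k<N. p k * (cmod (u k))\<^sup>2) * (w x * cnj (w x))"
        unfolding sum_distrib_right[symmetric] of_real_sum ..
      finally have "complex_of_real (\<Sum>k<N. p k * (cmod (u k))\<^sup>2) = complex_of_real 1"
        using x(2) by simp
      then show ?thesis unfolding sum of_real_eq_iff by simp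
    next
      case False
      then have "weight d a Z = 0"
        unfolding sum_W_on[OF fin(3), symmetric] w_def by simp
      then have "weight d a X = 0"
        using weights weight_nonneg[of d a X] weight_nonneg[of d a Y] by simp
      then show ?thesis unfolding sum by simp
    qed
  qed
  obtain N p \<phi> where ex: "pure_decomposition d Z ?\<rho> N p \<phi>"
  proof -
    define r where "r = weight d a Z"
    \<comment> \<open>The decomposition mixes the normalized \<open>w\<close> with the vacuum, with
      probabilities \<open>r\<close> and \<open>q\<close>. For \<open>r = 0\<close> the first vector
      has probability zero but must still be normalized, so the vacuum replaces the
      quotient.\<close>
    define \<phi> where "\<phi> k = (if k = 0 \<and> r \<noteq> 0 then \<lambda>z. w z / complex_of_real (sqrt r) else ket (vac Z))"
      for k :: nat
    have r: "0 \<le> r" "(\<Sum>z\<in>?B. (cmod (w z))\<^sup>2) = r"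
      unfolding r_def w_def by (auto simp: weight_nonneg sum_W_on fin)
    have "normalized d Z (ket (vac Z))"
      unfolding normalized_def ket_def using fin vac by (simp add: if_distrib if_distribR cong: if_cong)
    moreover have "normalized d Z (\<lambda>z. w z / complex_of_real (sqrt r))" if "r \<noteq> 0"
      unfolding normalized_def norm_divide power_divide sum_divide_distrib[symmetric] r(2)
      using r(1) that by simp
    ultimately have norm: "normalized d Z (\<phi> k)" for k unfolding \<phi>_def by auto
    have w_zero: "w z = 0" if "r = 0" "z \<in> ?B" for z
      using that r(2) fin by (simp add: sum_nonneg_eq_0_iff)
    have sq: "complex_of_real (sqrt r) * complex_of_real (sqrt r) = complex_of_real r"
      unfolding of_real_mult[symmetric] using r(1) by simp
    have first: "complex_of_real r * ketbra (\<phi> 0) z z' = w z * cnj (w z')"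
      if "z \<in> ?B" "z' \<in> ?B" for z z'
      using that w_zero sq by (cases "r = 0") (auto simp: ketbra_def \<phi>_def)
    have "pure_decomposition d Z ?\<rho> 2 (\<lambda>k. if k = 0 then r else q) \<phi>"
      unfolding pure_decomposition_def
      using r(1) total norm weight_nonneg[of d a "S - Z"]
      by (auto simp: numeral_2_eq_2 r_def[symmetric] q_def[symmetric] \<rho> first)
        (simp add: ketbra_def \<phi>_def ket_def)
    then show thesis by (rule that)
  qed
  show ?thesis
  proof (intro equalityI subsetI)
    fix c assume "c \<in> average_concurrences d X Y ?\<rho>"
    then show "c \<in> {?c}"
      using avg unfolding average_concurrences_def Z_def[symmetric] mem_Collect_eq by auto
  next
    fix c assume "c \<in> {?c}"
    then have "c = (\<Sum>k<N. p k * pure_concurrence d X Y (\<phi> k))"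
      using avg[OF ex] by simp
    then show "c \<in> average_concurrences d X Y ?\<rho>"
      using ex unfolding average_concurrences_def Z_def by blast
  qed
qed

section \<open>Concurrence across cuts and the monogamy relation\<close>

lemma concurrence_W:
  assumes "finite S" "X \<subseteq> S" "Y \<subseteq> S" "X \<inter> Y = {}" "0 < d" "weight d a S = 1"
  shows "C_cut d S (W_on d a S) X Y = 2 * sqrt (weight d a X * weight d a Y)"
    and "Ca_cut d S (W_on d a S) X Y = 2 * sqrt (weight d a X * weight d a Y)"
  unfolding C_cut_def Ca_cut_def concurrence_def concurrence_of_assistance_def
    average_concurrences_W[OF assms]
  by (auto intro: Least_equality Greatest_equality)

theorem lemma2:
  fixes n d :: nat and a :: "nat \<Rightarrow> nat \<Rightarrow> complex" and P :: "nat set set" and X :: "nat set"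
  assumes "1 \<le> n" and "2 \<le> d"
    and "(\<Sum>s\<in>{1..n}. \<Sum>i\<in>{1..<d}. (cmod (a s i))\<^sup>2) = 1"
    and "partition_on {1..n} P" and "X \<in> P"
  shows "(C_cut d {1..n} (W_state n d a) X (\<Union>(P - {X})))\<^sup>2
      = (\<Sum>Y\<in>P - {X}. (C_cut d {1..n} (W_state n d a) X Y)\<^sup>2)
    \<and> (\<Sum>Y\<in>P - {X}. (C_cut d {1..n} (W_state n d a) X Y)\<^sup>2)
      = (\<Sum>Y\<in>P - {X}. (Ca_cut d {1..n} (W_state n d a) X Y)\<^sup>2)
    \<and> (\<forall>Y\<in>P - {X}. C_cut d {1..n} (W_state n d a) X Y = Ca_cut d {1..n} (W_state n d a) X Y)"
proof -
  let ?S = "{1..n}"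
  have one: "weight d a ?S = 1" using assms(3) unfolding weight_def .
  have sub: "Y \<subseteq> ?S" if "Y \<in> P" for Y
    using assms(4) that unfolding partition_on_def by blast
  have disj: "Y \<inter> Y' = {}" if "Y \<in> P" "Y' \<in> P" "Y \<noteq> Y'" for Y Y'
    using assms(4) that by (meson disjointD partition_onD2)
  have C: "C_cut d ?S (W_on d a ?S) X Y = 2 * sqrt (weight d a X * weight d a Y)"
    "Ca_cut d ?S (W_on d a ?S) X Y = 2 * sqrt (weight d a X * weight d a Y)"
    if "Y \<subseteq> ?S" "X \<inter> Y = {}" for Y
    using concurrence_W[OF _ sub[OF assms(5)] that _ one] assms(2) by simp_all
  have sq: "(2 * sqrt (weight d a X * weight d a Y))\<^sup>2 = 4 * (weight d a X * weight d a Y)" for Y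
    using weight_nonneg[of d a] by (simp add: power_mult_distrib)
  have each: "C_cut d ?S (W_on d a ?S) X Y = 2 * sqrt (weight d a X * weight d a Y)"
    "Ca_cut d ?S (W_on d a ?S) X Y = 2 * sqrt (weight d a X * weight d a Y)"
    if "Y \<in> P - {X}" for Y
    using that C[OF sub disj[OF assms(5)], of Y] by auto
  have "weight d a (\<Union>(P - {X})) = (\<Sum>Y\<in>P - {X}. weight d a Y)"
    unfolding weight_def using finite_subset[OF sub] disj
    by (subst sum.Union_disjoint) simp_all
  \<comment> \<open>The joint system of the other parties is itself a subset of \<open>?S\<close>
    disjoint from \<open>X\<close>, so the same formula applies. For \<open>P = {X}\<close> it is
    empty and has weight 0.\<close>
  moreover have "C_cut d ?S (W_on d a ?S) X (\<Union>(P - {X}))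
      = 2 * sqrt (weight d a X * weight d a (\<Union>(P - {X})))"
    using sub disj[OF assms(5)] by (intro C(1)) blast+
  then have "(C_cut d ?S (W_on d a ?S) X (\<Union>(P - {X})))\<^sup>2
      = 4 * (weight d a X * weight d a (\<Union>(P - {X})))"
    by (simp only: sq)
  ultimately have "(C_cut d ?S (W_on d a ?S) X (\<Union>(P - {X})))\<^sup>2
      = (\<Sum>Y\<in>P - {X}. 4 * (weight d a X * weight d a Y))"
    by (simp only: sum_distrib_left)
  also have "\<dots> = (\<Sum>Y\<in>P - {X}. (C_cut d ?S (W_on d a ?S) X Y)\<^sup>2)"
    by (intro sum.cong refl) (simp only: each(1) sq)
  finally have "(C_cut d ?S (W_on d a ?S) X (\<Union>(P - {X})))\<^sup>2
      = (\<Sum>Y\<in>P - {X}. (C_cut d ?S (W_on d a ?S) X Y)\<^sup>2)" .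
  moreover have "C_cut d ?S (W_on d a ?S) X Y = Ca_cut d ?S (W_on d a ?S) X Y" if "Y \<in> P - {X}" for Y
    using each[OF that] by (simp only:)
  ultimately show ?thesis
    unfolding W_state_eq by (intro conjI ballI sum.cong refl) (simp_all only:)
qed

end
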